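(* Let $m\ge1$ be an integer. For $\mathbf{q}\in\mathcal{PK}_m(n)$ let $\mathcal{R}_0(\mathbf{q})=\mathrm{luck}(\mathbf{q})$ and $\mathcal{R}_i(\mathbf{q})=\omega_i(\mathbf{q})$ for $1\le i\le m$. Then (the $n=0$ term of the sum being $1$) $$\sum_{n\ge0}x^n\sum_{\mathbf{q}\in\mathcal{PK}_m(n)}\ \prod_{i=0}^{m}q_i^{\mathcal{R}_i(\mathbf{q})}=1+x\prod_{i=0}^{m}q_i\,\mathcal{B}_m(x;q_i).$$
   Context: $\mathrm{Cat}_m(n)$: the rooted tree with backbone a directed path $v_1\to v_2\to\cdots\to v_n$, with sink (root) $v_n$, where $v_2$ has $m$ leaves attached including $v_1$, and each $v_i$ with $i\ge3$ has $m-1$ additional leaves attached (all edges directed towards the sink; for $n=1$ the tree is a single vertex). It has $mn-m+1$ vertices, labelled $1,\dots,mn-m+1$ so that deeper vertices get smaller labels and, at equal depth, vertices of larger in-degree get smaller labels, with $v_1$ labelled $1$; thus the backbone vertex $v_i$ has label $m(i-1)+1$. A parking distribution on $\mathrm{Cat}_m(n)$ is a weakly increasing sequence of $mn-m+1$ preferred vertices (labels) such that all cars can park, where cars arrive in the order of the sequence, each goes to its preferred vertex and, if it is occupied, moves along the edges towards the sink until it finds an unoccupied vertex (leaving unparked if none is found). Equivalently, for every vertex $k$ the number of cars preferring a vertex in the subtree $T_k$ rooted at $k$ is at least $|T_k|$. $\mathcal{PK}_m(n)$ is the set of all of these. For $\mathbf{q}\in\mathcal{PK}_m(n)$, a car is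 lucky if it prefers a backbone vertex and parks at that vertex; $\mathrm{luck}(\mathbf{q})$ is the number of lucky cars, and $\omega_i(\mathbf{q})$ is the number of cars preferring node $i$. $\mathcal{PK}(n;\mathbf{u})$ for $\mathbf{u}=(1,m+1,2m+1,\dots)$ is the set of weakly increasing sequences of positive integers $\mathbf{p}=(p_1,\dots,p_n)$ with $p_i\le m(i-1)+1$ for all $i$ (only the empty sequence for $n=0$); on it, $\mathrm{luck}(\mathbf{p})=|\{i:p_i=mi-m+1\}|$, and $\mathcal{B}_m(x;q)=\sum_{n\ge0}x^n\sum_{\mathbf{p}\in\mathcal{PK}(n;\mathbf{u})}q^{\mathrm{luck}(\mathbf{p})}$.
   Formalization: For m≥2 the printed identity fails at x^1: the one-vertex tree has only the distribution (1), giving q_0q_1 rather than q_0q_1⋯q_m. The formal identity subtracts x(q_0q_1⋯q_m − q_0q_1) on the right; all other coefficients, and the case m=1, are as printed. *)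

theory Defs
  imports "HOL-Computational_Algebra.Formal_Power_Series"
begin

section \<open>Parking on a rooted tree\<close>

text \<open>
  A rooted tree is given by its set of edges \<open>E\<close>, directed towards the root, so that every vertex
  has at most one outgoing edge.  \<open>parks_at E occ v s\<close> says that a car preferring \<open>v\<close> finds its
  parking place at \<open>s\<close> when the vertices in \<open>occ\<close> are occupied; if the whole path from \<open>v\<close> to the
  root is occupied, there is no such \<open>s\<close>.
\<close>

inductive parks_at :: "('v \<times> 'v) set \<Rightarrow> 'v set \<Rightarrow> 'v \<Rightarrow> 'v \<Rightarrow> bool"
  for E :: "('v \<times> 'v) set" and occ :: "'v set" where
  free: "v \<notin> occ \<Longrightarrow> parks_at E occ v v"
| move: "v \<in> occ \<Longrightarrow> (v, w) \<in> E \<Longrightarrow> parks_at E occ w s \<Longrightarrow> parks_at E occ v s"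

text \<open>
  \<open>park_all E occ c ss\<close>: the cars with list of preferences \<open>c\<close>, arriving in this order, all park,
  the \<open>i\<close>-th car on the \<open>i\<close>-th vertex of \<open>ss\<close>.
\<close>

inductive park_all :: "('v \<times> 'v) set \<Rightarrow> 'v set \<Rightarrow> 'v list \<Rightarrow> 'v list \<Rightarrow> bool"
  for E :: "('v \<times> 'v) set" where
  Nil: "park_all E occ [] []"
| Cons: "parks_at E occ v s \<Longrightarrow> park_all E (insert s occ) c ss
    \<Longrightarrow> park_all E occ (v # c) (s # ss)"

lemma parks_at_unique:
  assumes "single_valued E" "parks_at E occ v s" "parks_at E occ v t"
  shows "s = t"
  using assms(2,3)
proof (induction arbitrary: t rule: parks_at.induct)
  case (free v)
  from free(2,1) show ?case by cases auto
next
  case (move v w s)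
  from \<open>parks_at E occ v t\<close> show ?case
  proof cases
    case free
    with move.hyps(1) show ?thesis by simp
  next
    case (move w')
    with \<open>(v, w) \<in> E\<close> assms(1) have "w' = w" by (auto dest: single_valuedD)
    with move move.IH \<open>\<And>t. parks_at E occ w t \<Longrightarrow> s = t\<close> show ?thesis by blast
  qed
qed

lemma park_all_unique:
  assumes "single_valued E" "park_all E occ c ss" "park_all E occ c ts"
  shows "ss = ts"
  using assms(2,3)
proof (induction arbitrary: ts rule: park_all.induct)
  case (Nil occ)
  then show ?case by cases auto
next
  case (Cons occ v s c ss)
  from \<open>park_all E occ (v # c) ts\<close> show ?case
  proof cases
    case (Cons t ts')
    with \<open>parks_at E occ v s\<close> have "t = s" by (metis assms(1) parks_at_unique)
    with Cons \<open>\<And>ts. park_all E (insert s occ) c ts \<Longrightarrow> ss = ts\<close> show ?thesis by blast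
  qed
qed

text \<open>Meaningful only if all cars park; then it is well-defined by \<open>park_all_unique\<close>.\<close>

definition parking_places :: "('v \<times> 'v) set \<Rightarrow> 'v list \<Rightarrow> 'v list" where
  "parking_places E c = (THE ss. park_all E {} c ss)"


section \<open>Caterpillars\<close>

definition backbone :: "nat \<Rightarrow> nat \<Rightarrow> nat" where
  "backbone m i = m * (i - 1) + 1"

text \<open>
  Vertices are identified with their labels.  For \<open>2 \<le> i \<le> n\<close> the \<open>m\<close> children of \<open>v\<^sub>i\<close> are
  \<open>v\<^sub>i\<^sub>-\<^sub>1\<close> (\<open>j = 0\<close> below) and \<open>m - 1\<close> leaves (\<open>1 \<le> j < m\<close>); being of the same depth as \<open>v\<^sub>i\<^sub>-\<^sub>1\<close>,
  the leaves carry the labels directly after that of \<open>v\<^sub>i\<^sub>-\<^sub>1\<close>.  The root is \<open>v\<^sub>n\<close>, which has the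
  largest label; for \<open>n = 1\<close> there are no edges and the only vertex is \<open>1\<close>.
\<close>

definition cat_vertices :: "nat \<Rightarrow> nat \<Rightarrow> nat set" where
  "cat_vertices m n = {1..backbone m n}"

definition cat_edges :: "nat \<Rightarrow> nat \<Rightarrow> (nat \<times> nat) set" where
  "cat_edges m n =
     {(backbone m (i - 1) + j, backbone m i) | i j. 2 \<le> i \<and> i \<le> n \<and> j < m}"

lemma single_valued_cat_edges: "single_valued (cat_edges m n)"
proof (rule single_valuedI)
  fix x y z
  assume "(x, y) \<in> cat_edges m n" "(x, z) \<in> cat_edges m n"
  then obtain i j k l where
    x: "x = backbone m (i - 1) + j" "x = backbone m (k - 1) + l" "j < m" "l < m" "2 \<le> i" "2 \<le> k"
    and yz: "y = backbone m i" "z = backbone m k"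
    unfolding cat_edges_def by blast
  have "(x - 1) div m = i - 1 - 1"
    using x(1,3) by (simp add: backbone_def)
  moreover have "(x - 1) div m = k - 1 - 1"
    using x(2,4) by (simp add: backbone_def)
  ultimately have "i - 1 - 1 = k - 1 - 1" by simp
  with x(5,6) have "i = k" by linarith
  with yz show "y = z" by simp
qed

text \<open>Only used for \<open>n \<ge> 1\<close>: the definitions above do not describe an empty tree for \<open>n = 0\<close>.\<close>

definition PK_cat :: "nat \<Rightarrow> nat \<Rightarrow> nat list set" where
  "PK_cat m n = {c. length c = card (cat_vertices m n) \<and> set c \<subseteq> cat_vertices m n \<and> sorted c \<and>
     (\<exists>ss. park_all (cat_edges m n) {} c ss)}"

definition luck_cat :: "nat \<Rightarrow> nat \<Rightarrow> nat list \<Rightarrow> nat" where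
  "luck_cat m n c = card {k. k < length c \<and> c ! k \<in> backbone m ` {1..n} \<and>
     parking_places (cat_edges m n) c ! k = c ! k}"

text \<open>
  For \<open>n = 1\<close> the tree has no vertices \<open>2, \<dots>, m\<close>, so the only parking distribution \<open>[1]\<close> has
  \<open>cat_stat m 1 i [1] = 0\<close> for \<open>2 \<le> i \<le> m\<close>, whereas for \<open>n \<ge> 2\<close> the vertices \<open>1, \<dots>, m\<close> are
  leaves and each of them is preferred by at least one car.
\<close>

definition cat_stat :: "nat \<Rightarrow> nat \<Rightarrow> nat \<Rightarrow> nat list \<Rightarrow> nat" where
  "cat_stat m n i c = (if i = 0 then luck_cat m n c else count_list c i)"


section \<open>Vector parking distributions\<close>

text \<open>
  List positions start at \<open>0\<close>, so the bound \<open>u i\<close> is the one usually written \<open>u\<^sub>i\<^sub>+\<^sub>1\<close>, and the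
  vector \<open>(1, m + 1, 2 m + 1, \<dots>)\<close> is \<open>\<lambda>i. m * i + 1\<close>.
\<close>

definition PK_vec :: "nat \<Rightarrow> (nat \<Rightarrow> nat) \<Rightarrow> nat list set" where
  "PK_vec n u = {p. length p = n \<and> sorted p \<and> (\<forall>i<n. 1 \<le> p ! i \<and> p ! i \<le> u i)}"

definition luck_vec :: "nat \<Rightarrow> nat list \<Rightarrow> nat" where
  "luck_vec m p = card {i. i < length p \<and> p ! i = m * i + 1}"

definition B_fps :: "nat \<Rightarrow> 'a::comm_ring_1 \<Rightarrow> 'a fps" where
  "B_fps m t = Abs_fps (\<lambda>n. \<Sum>p\<in>PK_vec n (\<lambda>i. m * i + 1). t ^ luck_vec m p)"

end

theory Submission
  imports Defs
begin

text \<open>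
  Let \<open>C\<close> be the Fuss--Catalan series with \<open>C = 1 + x C\<^sup>m\<^sup>+\<^sup>1\<close>, and put \<open>T = x C\<^sup>m\<close>.  Everything rests on
  the equations \<open>B\<^sub>m(x;t) = 1 / (1 - t T)\<close> and \<open>C = B\<^sub>m(x;1) = 1 / (1 - T)\<close>.
  The first equation comes from the gaps \<open>m i + 1 - p\<^sub>i\<close>, counting from \<open>i = 0\<close>, of a vector parking
  distribution: an entry adds \<open>m\<close> to the gap, a step to the next larger value lowers it by one.
  Being lucky means to have gap zero.  By \<open>gap_recurrence_unique\<close>, every unit of gap contributes
  a factor \<open>C\<close>, so that \<open>B = 1 + t x C\<^sup>m B\<close> (\<open>B_fps_eq\<close>).
  
  A weakly increasing sequence of labels is a parking distribution of the caterpillar if and only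
  if its \<open>i\<close>-th entry is at most \<open>i\<close>, for every \<open>i\<close>, and it contains every leaf
  (\<open>PK_cat_eq_cat_prefs\<close>).  The lucky cars are then those at a position that is the label of a
  backbone vertex and equal to the entry there (\<open>luck_cat_eq\<close>).  Read such a sequence label by
  label, and record the excess, which is the number of cars so far minus the number of labels passed.
  The excess never becomes negative.  A car at a leaf beyond the mandatory one raises the excess, a
  backbone vertex without a car lowers it, and a lucky car occurs exactly when a backbone vertex is
  reached with excess zero.  Let \<open>x\<close> mark the backbone vertices.  Then lowering the excess by one has
  generating function \<open>T\<close>: the next backbone vertex gives \<open>x\<close>, and it and each of the \<open>m - 1\<close> leaves
  between it and the one after it may receive any number of extra cars.  Every extra car has to be undone,
  so that each of these \<open>m\<close> labels gives \<open>1 / (1 - T) = C\<close>.  Likewise an excursion from excess zero back to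
  excess zero has generating function \<open>q\<^sub>0 T\<close>.  A walk that starts with excess \<open>h\<close> in front of a
  backbone vertex therefore has generating function \<open>T\<^sup>h / (1 - q\<^sub>0 T) = T\<^sup>h B\<^sub>m(x;q\<^sub>0)\<close>.
  
  For \<open>n \<ge> 2\<close>, the labels before the backbone vertex \<open>m + 1\<close> are the leaves \<open>1, \<dots>, m\<close>.  Each of them receives its
  mandatory car, of weight \<open>q\<^sub>i\<close>, and extra cars, each of weight \<open>q\<^sub>i\<close> and raising the excess by one.
  Together they give \<open>q\<^sub>i / (1 - q\<^sub>i T) = q\<^sub>i B\<^sub>m(x;q\<^sub>i)\<close>.  The factor \<open>q\<^sub>0\<close> is due to the first car, which
  is always lucky.  If \<open>n = 1\<close>, the labels \<open>2, \<dots>, m\<close> do not exist; this accounts for the correction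
  of the coefficient of \<open>x\<close>.
  
  In the formal proof, the sums over the possible continuations satisfy a recursion that adds one car
  or passes one label at a time (\<open>cat_sum_rec\<close>), and the products of series above satisfy the same
  recursion, so no infinite sum over the numbers of extra cars occurs.
\<close>

unbundle fps_syntax

section \<open>A first-passage recurrence and the Fuss--Catalan series\<close>

text \<open>
  Continuations of a vector parking distribution by \<open>n\<close> entries, when the bound for the next entry
  exceeds the current value by the gap \<open>g\<close>.  In the last equation either the gap is reduced, or an entry is made with
  exactly this gap, and the next bound is larger by \<open>m\<close>.  An entry with gap zero has weight \<open>t\<close>; for
  \<open>t = 0\<close> one counts the walks that do not use gap zero, which are the first-passage walks.
\<close>

fun gap_sum :: "nat \<Rightarrow> 'a::comm_ring_1 \<Rightarrow> nat \<Rightarrow> nat \<Rightarrow> 'a" where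
  "gap_sum m t 0 g = 1"
| "gap_sum m t (Suc n) 0 = t * gap_sum m t n m"
| "gap_sum m t (Suc n) (Suc g) = gap_sum m t (Suc n) g + gap_sum m t n (Suc g + m)"

definition gap_fps :: "nat \<Rightarrow> 'a::comm_ring_1 \<Rightarrow> nat \<Rightarrow> 'a fps" where
  "gap_fps m t g = Abs_fps (\<lambda>n. gap_sum m t n g)"

definition fuss_catalan :: "nat \<Rightarrow> 'a::comm_ring_1 fps" where
  "fuss_catalan m = gap_fps m 0 1"

lemma gap_fps_0: "gap_fps m t 0 = 1 + fps_const t * fps_X * gap_fps m t m"
proof (rule fps_ext)
  fix n
  show "gap_fps m t 0 $ n = (1 + fps_const t * fps_X * gap_fps m t m) $ n"
    by (cases n) (simp_all add: gap_fps_def mult.assoc)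
qed

lemma gap_fps_Suc: "gap_fps m t (Suc g) = gap_fps m t g + fps_X * gap_fps m t (Suc g + m)"
proof (rule fps_ext)
  fix n
  show "gap_fps m t (Suc g) $ n = (gap_fps m t g + fps_X * gap_fps m t (Suc g + m)) $ n"
    by (cases n) (simp_all add: gap_fps_def)
qed

text \<open>
  The coefficient of \<open>x\<^sup>n\<close> in \<open>F (Suc g)\<close> depends on \<open>F g\<close> and on coefficients of lower degree only, so
  the recurrence leaves no freedom but \<open>F 0\<close>; the walks for \<open>t = 0\<close> give the solution that starts with 1.
\<close>

lemma gap_recurrence_unique:
  fixes F :: "nat \<Rightarrow> 'a::comm_ring_1 fps"
  assumes F: "\<And>g. F (Suc g) = F g + fps_X * F (Suc g + m)"
  shows "F g = F 0 * gap_fps m 0 g"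
proof -
  define D where "D g = F g - F 0 * gap_fps m 0 g" for g
  have D_0: "D 0 = 0"
    by (simp add: D_def gap_fps_0)
  have D_Suc: "D (Suc g) = D g + fps_X * D (Suc g + m)" for g
    unfolding D_def by (subst F, subst gap_fps_Suc) (simp add: algebra_simps)
  have "D g $ n = 0" for n g
  proof (induction n arbitrary: g)
    case 0
    show ?case
    proof (induction g)
      case (Suc g)
      then show ?case by (subst D_Suc) simp
    qed (simp add: D_0)
  next
    case (Suc n)
    note IH = Suc
    show ?case
    proof (induction g)
      case (Suc g)
      then show ?case using IH by (subst D_Suc) simp
    qed (simp add: D_0)
  qed
  then have "D g = 0"
    by (simp add: fps_eq_iff)
  then show ?thesis
    by (simp add: D_def)
qed

text \<open>
  To get from gap \<open>g + 1\<close> to gap zero for the first time, one first has to get down by \<open>g\<close>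
  and then from 1 to 0.  Algebraically: the shifted solution also satisfies the recurrence.
\<close>

lemma gap_fps_zero_eq_power: "gap_fps m 0 g = fuss_catalan m ^ g"
proof (induction g)
  case 0
  show ?case by (simp add: gap_fps_0)
next
  case (Suc g)
  have "gap_fps m (0::'a) (Suc (Suc g)) =
      gap_fps m 0 (Suc g) + fps_X * gap_fps m 0 (Suc (Suc g + m))" for g
    by (subst gap_fps_Suc) simp
  from gap_recurrence_unique[of "\<lambda>g. gap_fps m 0 (Suc g)", OF this, of g] Suc
  show ?case by (simp add: fuss_catalan_def)
qed

lemma gap_fps_eq_power: "gap_fps m t g = gap_fps m t 0 * fuss_catalan m ^ g"
  unfolding gap_fps_zero_eq_power[symmetric]
  by (rule gap_recurrence_unique) (rule gap_fps_Suc)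

section \<open>Vector parking distributions\<close>

text \<open>
  The possible last \<open>n\<close> entries after \<open>i\<close> entries that are at most \<open>v\<close>.
\<close>

definition vec_suffixes :: "nat \<Rightarrow> nat \<Rightarrow> nat \<Rightarrow> nat \<Rightarrow> nat list set" where
  "vec_suffixes m n i v =
     {p. length p = n \<and> sorted p \<and> (\<forall>j<n. v \<le> p ! j \<and> p ! j \<le> m * (i + j) + 1)}"

lemma vec_suffixes_0: "vec_suffixes m 0 i v = {[]}"
  by (auto simp: vec_suffixes_def)

lemma finite_vec_suffixes: "finite (vec_suffixes m n i v)"
proof (rule finite_subset)
  show "vec_suffixes m n i v \<subseteq> {p. set p \<subseteq> {..m * (i + n) + 1} \<and> length p = n}"
  proof
    fix p assume p: "p \<in> vec_suffixes m n i v"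
    have "x \<le> m * (i + n) + 1" if x: "x \<in> set p" for x
    proof -
      from x p obtain j where "j < n" "x = p ! j" "p ! j \<le> m * (i + j) + 1"
        by (auto simp: vec_suffixes_def in_set_conv_nth)
      moreover from \<open>j < n\<close> have "m * (i + j) \<le> m * (i + n)" by simp
      ultimately show ?thesis by linarith
    qed
    with p show "p \<in> {p. set p \<subseteq> {..m * (i + n) + 1} \<and> length p = n}"
      by (auto simp: vec_suffixes_def)
  qed
  show "finite {p. set p \<subseteq> {..m * (i + n) + 1} \<and> length p = n}"
    by (rule finite_lists_length_eq) simp
qed

lemma mem_vec_suffixes_Suc_iff:
  "p \<in> vec_suffixes m (Suc n) i v \<longleftrightarrow>
     (\<exists>x p'. p = x # p' \<and> v \<le> x \<and> x \<le> m * i + 1 \<and> p' \<in> vec_suffixes m n (Suc i) x)"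
proof (cases p)
  case (Cons x p')
  then show ?thesis
    by (auto simp: vec_suffixes_def All_less_Suc2 all_set_conv_all_nth)
qed (simp add: vec_suffixes_def)

definition vec_weight :: "nat \<Rightarrow> 'a::comm_ring_1 \<Rightarrow> nat \<Rightarrow> nat list \<Rightarrow> 'a" where
  "vec_weight m t i p = (\<Prod>j<length p. if p ! j = m * (i + j) + 1 then t else 1)"

lemma vec_weight_Nil: "vec_weight m t i [] = 1"
  by (simp add: vec_weight_def)

lemma vec_weight_Cons:
  "vec_weight m t i (x # p) = (if x = m * i + 1 then t else 1) * vec_weight m t (Suc i) p"
  by (simp add: vec_weight_def prod.lessThan_Suc_shift del: prod.lessThan_Suc)

text \<open>
  If \<open>v\<close> is below the bound of the next entry, then that entry either is \<open>v\<close> or all entries are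
  larger than \<open>v\<close>; this is the recursion of \<open>gap_sum\<close>.
\<close>

lemma sum_vec_suffixes:
  "m * i + 1 = v + g \<Longrightarrow> (\<Sum>p\<in>vec_suffixes m n i v. vec_weight m t i p) = gap_sum m t n g"
proof (induction m t n g arbitrary: i v rule: gap_sum.induct)
  case (1 m t g)
  show ?case by (simp add: vec_suffixes_0 vec_weight_Nil)
next
  case (2 m t n)
  have "vec_suffixes m (Suc n) i v = (#) v ` vec_suffixes m n (Suc i) v"
    using "2.prems" by (auto simp: mem_vec_suffixes_Suc_iff)
  then show ?case
    using "2.IH"[of "Suc i" v] "2.prems"
    by (simp add: sum.reindex vec_weight_Cons flip: sum_distrib_left)
next
  case (3 m t n g)
  have split: "vec_suffixes m (Suc n) i v =
      vec_suffixes m (Suc n) i (Suc v) \<union> (#) v ` vec_suffixes m n (Suc i) v"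
  proof (intro set_eqI iffI)
    fix p assume "p \<in> vec_suffixes m (Suc n) i v"
    then obtain x p' where "p = x # p'" "v \<le> x" "x \<le> m * i + 1" "p' \<in> vec_suffixes m n (Suc i) x"
      by (auto simp: mem_vec_suffixes_Suc_iff)
    then show "p \<in> vec_suffixes m (Suc n) i (Suc v) \<union> (#) v ` vec_suffixes m n (Suc i) v"
      by (cases "x = v") (simp_all add: mem_vec_suffixes_Suc_iff)
  next
    fix p assume "p \<in> vec_suffixes m (Suc n) i (Suc v) \<union> (#) v ` vec_suffixes m n (Suc i) v"
    then show "p \<in> vec_suffixes m (Suc n) i v"
      using "3.prems" by (auto simp: mem_vec_suffixes_Suc_iff)
  qed
  have disj: "vec_suffixes m (Suc n) i (Suc v) \<inter> (#) v ` vec_suffixes m n (Suc i) v = {}"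
    by (auto simp: mem_vec_suffixes_Suc_iff)
  show ?case
    unfolding split
    using "3.IH"(1)[of i "Suc v"] "3.IH"(2)[of "Suc i" v] "3.prems" disj
    by (simp add: sum.union_disjoint finite_vec_suffixes sum.reindex vec_weight_Cons)
qed

lemma B_fps_eq_gap_fps: "B_fps m t = gap_fps m t 0"
proof (rule fps_ext)
  fix n
  have "PK_vec n (\<lambda>i. m * i + 1) = vec_suffixes m n 0 1"
    by (auto simp: PK_vec_def vec_suffixes_def)
  moreover have "t ^ luck_vec m p = vec_weight m t 0 p" for p
    by (simp add: luck_vec_def vec_weight_def prod.If_cases Int_def)
  ultimately show "B_fps m t $ n = gap_fps m t 0 $ n"
    using sum_vec_suffixes[where m = m and i = 0 and v = 1 and g = 0 and n = n and t = t]
    by (simp add: B_fps_def gap_fps_def)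
qed

text \<open>
  A parking distribution is empty or starts with the lucky entry 1, after which the gap is \<open>m\<close>
  and contributes \<open>C\<^sup>m\<close>.
\<close>

lemma B_fps_eq: "B_fps m t = 1 + fps_const t * (fps_X * fuss_catalan m ^ m) * B_fps m t"
proof -
  have "gap_fps m t 0 = 1 + fps_const t * fps_X * gap_fps m t m"
    by (rule gap_fps_0)
  also have "gap_fps m t m = gap_fps m t 0 * fuss_catalan m ^ m"
    by (rule gap_fps_eq_power)
  finally show ?thesis
    by (simp only: B_fps_eq_gap_fps mult_ac)
qed

lemma one_minus_inverse_iff:
  fixes b y :: "'a::comm_ring_1"
  shows "b * (1 - y) = 1 \<longleftrightarrow> b = 1 + y * b"
proof -
  have "b * (1 - y) = b - y * b"
    by (simp add: right_diff_distrib mult.commute)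
  then show ?thesis
    by (simp only: diff_eq_eq)
qed

lemma B_fps_inverse: "B_fps m t * (1 - fps_const t * (fps_X * fuss_catalan m ^ m)) = 1"
  unfolding one_minus_inverse_iff by (rule B_fps_eq)

lemma fuss_catalan_inverse: "fuss_catalan m * (1 - fps_X * fuss_catalan m ^ m) = 1"
proof -
  have "gap_fps m 0 1 = gap_fps m 0 0 + fps_X * gap_fps m 0 (1 + m)"
    using gap_fps_Suc[of m 0 0] by simp
  then show ?thesis
    unfolding one_minus_inverse_iff gap_fps_zero_eq_power
    by (simp add: mult_ac)
qed

lemma B_fps_1: "B_fps m 1 = fuss_catalan m"
proof -
  let ?C = "fuss_catalan m :: 'a fps"
  have "B_fps m 1 = B_fps m 1 * (?C * (1 - fps_X * ?C ^ m))"
    by (simp only: fuss_catalan_inverse mult_1_right)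
  also have "\<dots> = B_fps m 1 * (1 - fps_const 1 * (fps_X * ?C ^ m)) * ?C"
    by (simp only: fps_const_1_eq_1 mult_1_left mult_ac)
  also have "\<dots> = ?C"
    by (simp only: B_fps_inverse mult_1_left)
  finally show ?thesis .
qed

lemma B_fps_nth_0: "B_fps m t $ 0 = 1"
  by (subst B_fps_eq) simp

section \<open>Parking on a caterpillar\<close>

lemma parks_at_not_occupied:
  assumes "parks_at E occ v s"
  shows "s \<notin> occ"
  using assms by induction auto

lemma parks_at_preferred_free:
  assumes "parks_at E occ v s" "v \<notin> occ"
  shows "s = v"
  using assms by (cases rule: parks_at.cases) auto

text \<open>
  An explicit description of parking that gives access to the single cars.
\<close>

lemma park_all_iff:
  "park_all E occ c ss \<longleftrightarrow> length ss = length c \<and>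
     (\<forall>i<length c. parks_at E (occ \<union> set (take i ss)) (c ! i) (ss ! i))"
proof (induction c arbitrary: occ ss)
  case Nil
  show ?case by (auto intro: park_all.Nil elim: park_all.cases)
next
  case (Cons v c)
  have "park_all E occ (v # c) ss \<longleftrightarrow>
      (\<exists>s ss'. ss = s # ss' \<and> parks_at E occ v s \<and> park_all E (insert s occ) c ss')"
    by (auto intro: park_all.Cons elim: park_all.cases)
  also have "\<dots> \<longleftrightarrow> length ss = length (v # c) \<and>
     (\<forall>i<length (v # c). parks_at E (occ \<union> set (take i ss)) ((v # c) ! i) (ss ! i))"
    by (cases ss) (auto simp: Cons.IH All_less_Suc2)
  finally show ?case .
qed

lemma park_all_distinct: "park_all E occ c ss \<Longrightarrow> distinct ss \<and> set ss \<inter> occ = {}"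
  by (induction rule: park_all.induct) (auto dest: parks_at_not_occupied)

text \<open>
  The target of an edge is the first backbone vertex after its source.
\<close>

lemma mem_cat_edges_iff:
  assumes "m \<ge> 1"
  shows "(x, y) \<in> cat_edges m n \<longleftrightarrow>
     1 \<le> x \<and> x \<le> m * (n - 1) \<and> y = m * ((x - 1) div m + 1) + 1"
proof
  assume "(x, y) \<in> cat_edges m n"
  then obtain i j where ij: "x = m * (i - 1 - 1) + 1 + j" "y = m * (i - 1) + 1"
    "2 \<le> i" "i \<le> n" "j < m"
    unfolding cat_edges_def backbone_def by auto
  obtain i' where i': "i = i' + 2" using \<open>2 \<le> i\<close> by (metis le_add_diff_inverse2)
  have "m * i' + m \<le> m * (n - 1)"
    using ij(4) i' mult_le_mono2[of "i' + 1" "n - 1" m] by (simp add: add.commute)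
  then show "1 \<le> x \<and> x \<le> m * (n - 1) \<and> y = m * ((x - 1) div m + 1) + 1"
    using ij i' by simp
next
  assume *: "1 \<le> x \<and> x \<le> m * (n - 1) \<and> y = m * ((x - 1) div m + 1) + 1"
  define i where "i = (x - 1) div m + 2"
  have "x = backbone m (i - 1) + (x - 1) mod m" "y = backbone m i"
    using * by (auto simp: i_def backbone_def mult_div_mod_eq)
  moreover have "(x - 1) mod m < m" using assms by simp
  moreover have "(x - 1) div m < n - 1"
    using * assms by (subst div_less_iff_less_mult) (auto simp: mult.commute)
  then have "i \<le> n" by (simp add: i_def)
  ultimately show "(x, y) \<in> cat_edges m n"
    unfolding cat_edges_def
    by (intro CollectI exI[of _ i] exI[of _ "(x - 1) mod m"]) (auto simp: i_def)
qed

context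
  fixes m :: nat
  assumes m: "m \<ge> 1"
begin

lemma next_backbone_gt: "1 \<le> x \<Longrightarrow> x < m * ((x - 1) div m + 1) + 1"
  using m dividend_less_times_div[of m "x - 1"] by (simp add: algebra_simps)

lemma next_backbone_least: "1 \<le> x \<Longrightarrow> x \<le> m * j \<Longrightarrow> (x - 1) div m + 1 \<le> j"
  using m by (simp add: Suc_le_eq div_less_iff_less_mult mult.commute)

lemma parks_at_ge:
  assumes "parks_at (cat_edges m n) occ v s"
  shows "v \<le> s"
  using assms
proof induction
  case (move v w s)
  then show ?case using next_backbone_gt[of v] by (simp add: mem_cat_edges_iff[OF m])
qed simp

text \<open>
  A path to the root that starts at or before a backbone vertex passes through this vertex, so a free
  backbone vertex is a barrier that no car crosses.
\<close>

lemma parks_at_le_free_backbone: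
  assumes "parks_at (cat_edges m n) occ v s" "m * j + 1 \<notin> occ" "v \<le> m * j + 1"
  shows "s \<le> m * j + 1"
  using assms
proof induction
  case (move v w s)
  from move.hyps move.prems have "v \<noteq> m * j + 1" by auto
  with move have "(v - 1) div m + 1 \<le> j"
    by (intro next_backbone_least) (auto simp: mem_cat_edges_iff[OF m])
  then have "m * ((v - 1) div m + 1) \<le> m * j" by (rule mult_le_mono2)
  with move show ?case by (auto simp: mem_cat_edges_iff[OF m])
qed simp

lemma parks_at_le_root:
  assumes "parks_at (cat_edges m n) occ v s" "v \<le> m * (n - 1) + 1"
  shows "s \<le> m * (n - 1) + 1"
  using assms
proof induction
  case (move v w s)
  then have "(v - 1) div m + 1 \<le> n - 1"
    by (intro next_backbone_least) (auto simp: mem_cat_edges_iff[OF m])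
  then have "m * ((v - 1) div m + 1) \<le> m * (n - 1)" by (rule mult_le_mono2)
  with move show ?case by (auto simp: mem_cat_edges_iff[OF m])
qed simp

text \<open>
  No edge ends in a leaf.  The leaf 1 is not covered, as 1 has the form of a backbone label.
\<close>

lemma parks_at_leaf:
  assumes "parks_at (cat_edges m n) occ v s" "\<not> m dvd s - 1"
  shows "s = v"
  using assms by induction (auto simp: mem_cat_edges_iff[OF m])

text \<open>
  A free backbone vertex on the way (or a free preferred vertex) lets the car park.
\<close>

lemma parks_at_exists:
  assumes "1 \<le> v" "v \<le> m * j + 1" "j \<le> n - 1" "v \<notin> occ \<or> m * j + 1 \<notin> occ"
  shows "\<exists>s. parks_at (cat_edges m n) occ v s"
  using assms
proof (induction "m * j + 1 - v" arbitrary: v rule: less_induct)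
  case less
  show ?case
  proof (cases "v \<in> occ")
    case False
    then show ?thesis by (blast intro: parks_at.free)
  next
    case True
    with less.prems have v: "v \<le> m * j" by (cases "v = m * j + 1") auto
    define w where "w = m * ((v - 1) div m + 1) + 1"
    have "v < w" using next_backbone_gt less.prems(1) by (simp add: w_def)
    have "w \<le> m * j + 1"
      unfolding w_def using mult_le_mono2[OF next_backbone_least[OF less.prems(1) v], of m] by simp
    have "\<exists>s. parks_at (cat_edges m n) occ w s"
      using less.prems True v \<open>v < w\<close> \<open>w \<le> m * j + 1\<close> by (intro less.hyps) auto
    moreover have "(v, w) \<in> cat_edges m n"
      using less.prems(1) order_trans[OF v mult_le_mono2[OF less.prems(3), of m]]
      by (simp add: mem_cat_edges_iff[OF m] w_def)
    ultimately show ?thesis using True by (blast intro: parks_at.move)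
  qed
qed

end

text \<open>
  The bounds say that, for every \<open>k\<close>, at least \<open>k\<close> cars prefer one of the labels \<open>1, \<dots>, k\<close>.  For the
  label of a backbone vertex this is the condition on its subtree; for the other labels it follows from
  the presence of all leaves, but it is convenient to have it for all of them.
\<close>

definition cat_prefs :: "nat \<Rightarrow> nat \<Rightarrow> nat list set" where
  "cat_prefs m N = {c. length c = N \<and> sorted c \<and> (\<forall>i<N. 1 \<le> c ! i \<and> c ! i \<le> i + 1) \<and>
     (\<forall>l. 1 \<le> l \<and> l \<le> N \<and> \<not> m dvd l - 1 \<longrightarrow> l \<in> set c)}"

text \<open>
  There are as many cars as vertices, so the parking places exhaust the tree.
\<close>

lemma park_all_cat:
  assumes m: "m \<ge> 1" and N: "N = m * (n - 1) + 1"
    and len: "length c = N" and set_c: "set c \<subseteq> {1..N}" 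
    and park: "park_all (cat_edges m n) {} c ss"
  shows "length ss = N" "distinct ss" "set ss = {1..N}"
    "\<And>i. i < N \<Longrightarrow> parks_at (cat_edges m n) (set (take i ss)) (c ! i) (ss ! i)"
proof -
  show len_ss: "length ss = N" and
    parks: "\<And>i. i < N \<Longrightarrow> parks_at (cat_edges m n) (set (take i ss)) (c ! i) (ss ! i)"
    using park len by (auto simp: park_all_iff)
  show dist: "distinct ss"
    using park_all_distinct[OF park] by simp
  have "set ss \<subseteq> {1..N}"
  proof
    fix s assume "s \<in> set ss"
    then obtain i where i: "i < N" "s = ss ! i" using len_ss by (auto simp: in_set_conv_nth)
    have "c ! i \<in> {1..N}" using i len set_c nth_mem by blast
    with parks_at_ge[OF m parks[OF i(1)]] parks_at_le_root[OF m parks[OF i(1)]] i N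
    show "s \<in> {1..N}" by auto
  qed
  moreover have "card (set ss) = card {1..N}"
    using dist len_ss by (simp add: distinct_card)
  ultimately show "set ss = {1..N}"
    by (simp add: card_subset_eq)
qed

text \<open>
  Cars move to larger labels only, so the places up to \<open>k\<close> are taken by cars with preferences up to \<open>k\<close>.
\<close>

lemma small_places_from_small_preferences:
  assumes m: "m \<ge> 1" and N: "N = m * (n - 1) + 1"
    and len: "length c = N" and set_c: "set c \<subseteq> {1..N}" 
    and park: "park_all (cat_edges m n) {} c ss" and "k \<le> N"
  shows "{1..k} \<subseteq> (!) ss ` {i. i < N \<and> c ! i \<le> k}"
proof
  note P = park_all_cat[OF m N len set_c park]
  fix s assume s: "s \<in> {1..k}"
  with P(3) \<open>k \<le> N\<close> have "s \<in> set ss" by auto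
  then obtain i where i: "i < N" "s = ss ! i" using P(1) by (auto simp: in_set_conv_nth)
  with parks_at_ge[OF m P(4)[OF i(1)]] s have "c ! i \<le> k" by auto
  with i show "s \<in> (!) ss ` {i. i < N \<and> c ! i \<le> k}" by blast
qed

text \<open>
  If the preference at position \<open>i\<close> were larger than \<open>i + 1\<close>, only the \<open>i\<close> cars before it could fill the
  \<open>i + 1\<close> smallest places.  A leaf is filled only by a car that prefers it.
\<close>

lemma park_all_imp_cat_prefs:
  assumes m: "m \<ge> 1" and N: "N = m * (n - 1) + 1"
    and len: "length c = N" and set_c: "set c \<subseteq> {1..N}" and sorted: "sorted c"
    and park: "park_all (cat_edges m n) {} c ss"
  shows "c \<in> cat_prefs m N"
proof -
  note P = park_all_cat[OF m N len set_c park]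
  have "c ! i \<le> i + 1" if i: "i < N" for i
  proof (rule ccontr)
    assume *: "\<not> c ! i \<le> i + 1"
    have "{j. j < N \<and> c ! j \<le> i + 1} \<subseteq> {..<i}"
    proof
      fix j assume j: "j \<in> {j. j < N \<and> c ! j \<le> i + 1}"
      show "j \<in> {..<i}"
      proof (rule ccontr)
        assume "j \<notin> {..<i}"
        with j sorted len have "c ! i \<le> c ! j" by (auto intro: sorted_nth_mono)
        with * j show False by simp
      qed
    qed
    moreover have "{1..i + 1} \<subseteq> (!) ss ` {j. j < N \<and> c ! j \<le> i + 1}"
      using i by (intro small_places_from_small_preferences[OF m N len set_c park]) simp
    ultimately have "{1..i + 1} \<subseteq> (!) ss ` {..<i}" by blast
    then have "card {1..i + 1} \<le> card ((!) ss ` {..<i})" by (intro card_mono) auto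
    also have "\<dots> \<le> card {..<i}" by (rule card_image_le) simp
    finally show False by simp
  qed
  moreover have "l \<in> set c" if "1 \<le> l" "l \<le> N" "\<not> m dvd l - 1" for l
  proof -
    from that P(3) have "l \<in> set ss" by simp
    then obtain i where i: "i < N" "l = ss ! i" using P(1) by (auto simp: in_set_conv_nth)
    with parks_at_leaf[OF m P(4)[OF i(1)]] that have "l = c ! i" by simp
    with i len show ?thesis by (metis nth_mem)
  qed
  moreover have "1 \<le> c ! i" if "i < N" for i
    using that len set_c by (meson atLeastAtMost_iff nth_mem subsetD)
  ultimately show ?thesis
    using len sorted by (simp add: cat_prefs_def)
qed

text \<open>
  Suppose that the car at position \<open>p\<close> is stuck.  Then all backbone vertices are occupied: one at or beyond the
  preference is on the way of the stuck car, and a free one with smaller label \<open>K\<close> would be a barrier for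
  the first \<open>K\<close> cars, which have parked already, prefer labels up to \<open>K\<close> and would have had only \<open>K - 1\<close> places.  Hence the at least
  \<open>N - p\<close> free vertices are leaves, and each of them is preferred by a car after position \<open>p\<close>; but there
  are only \<open>N - p - 1\<close> of those.
\<close>

lemma cat_prefs_next_car_parks:
  assumes m: "m \<ge> 1" and N: "N = m * (n - 1) + 1" and c: "c \<in> cat_prefs m N"
    and p: "p < N" and park: "park_all (cat_edges m n) {} (take p c) ss"
  shows "\<exists>s. parks_at (cat_edges m n) (set ss) (c ! p) s"
proof (rule ccontr)
  let ?v = "c ! p"
  assume stuck: "\<not> ?thesis"
  have len: "length c = N" and sorted: "sorted c"
    and bounds: "\<And>i. i < N \<Longrightarrow> 1 \<le> c ! i \<and> c ! i \<le> i + 1"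
    and leaf: "\<And>l. 1 \<le> l \<Longrightarrow> l \<le> N \<Longrightarrow> \<not> m dvd l - 1 \<Longrightarrow> l \<in> set c"
    using c by (auto simp: cat_prefs_def)
  have len_ss: "length ss = p"
    and parks: "\<And>i. i < p \<Longrightarrow> parks_at (cat_edges m n) (set (take i ss)) (c ! i) (ss ! i)"
    using park len p by (auto simp: park_all_iff)
  have mono: "set (take i ss) \<subseteq> set ss" for i by (rule set_take_subset)
  have v_le: "?v \<le> N" using bounds[OF p] p by linarith
  have v_occ: "?v \<in> set ss"
    using stuck by (metis parks_at.free)
  have no_free_backbone: "m * j + 1 \<in> set ss" if j: "j \<le> n - 1" for j
  proof (rule ccontr)
    let ?K = "m * j + 1"
    assume free: "?K \<notin> set ss"
    have K_less: "?K < ?v"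
      using parks_at_exists[OF m, of ?v j n "set ss"] stuck free j bounds[OF p] by force
    have K_le: "?K \<le> N" using K_less v_le by simp
    have K_p: "?K \<le> p" using K_less bounds[OF p] by linarith
    have "ss ! i \<le> ?K \<and> ss ! i \<ge> 1" if i: "i < ?K" for i
    proof -
      have "c ! i \<le> ?K" "1 \<le> c ! i" using bounds[of i] i K_le by auto
      moreover from i K_p have "i < p" by simp
      moreover have "?K \<notin> set (take i ss)" using free mono by blast
      ultimately show ?thesis
        using parks_at_le_free_backbone[OF m parks[of i], of j] parks_at_ge[OF m parks[of i]] by auto
    qed
    moreover have "ss ! i \<noteq> ?K" if "i < ?K" for i
      using that K_p len_ss free by (metis nth_mem order_less_le_trans)
    ultimately have sub: "(!) ss ` {..<?K} \<subseteq> {1..<?K}"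
      by (force simp: order_less_le)
    have "distinct ss"
      using park_all_distinct[OF park] by simp
    then have "inj_on ((!) ss) {..<?K}"
      using K_p len_ss by (intro inj_on_nth) auto
    then have "card {..<?K} \<le> card {1..<?K}"
      using sub by (intro card_inj_on_le) auto
    then show False by simp
  qed
  have "{1..N} - set ss \<subseteq> (!) c ` {p<..<N}"
  proof
    fix l assume l: "l \<in> {1..N} - set ss"
    have "\<not> m dvd l - 1"
    proof
      assume "m dvd l - 1"
      then obtain j where "l - 1 = m * j" by auto
      with l have l_eq: "l = m * j + 1" and "l \<le> N" by auto
      with N have "m * j \<le> m * (n - 1)" by linarith
      with m have "j \<le> n - 1" by (simp add: Suc_le_eq)
      with l_eq show False using no_free_backbone[of j] l by simp
    qed
    with l leaf obtain i where i: "i < N" "l = c ! i"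
      by (metis Diff_iff atLeastAtMost_iff in_set_conv_nth len)
    have "i \<noteq> p" using v_occ l i by auto
    moreover have "\<not> i < p"
    proof
      assume "i < p"
      have "c ! i \<notin> set (take i ss)" using l i mono by blast
      with parks_at_preferred_free[OF parks[OF \<open>i < p\<close>]] have "ss ! i = l" using i by simp
      with \<open>i < p\<close> len_ss l show False by auto
    qed
    ultimately show "l \<in> (!) c ` {p<..<N}" using i by auto
  qed
  then have "card ({1..N} - set ss) \<le> card ((!) c ` {p<..<N})" by (intro card_mono) auto
  also have "\<dots> \<le> card {p<..<N}" by (rule card_image_le) simp
  finally have "card ({1..N} - set ss) \<le> N - Suc p" by simp
  moreover have "N - card (set ss) \<le> card ({1..N} - set ss)"
    using diff_card_le_card_Diff[of "set ss" "{1..N}"] by simp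
  moreover have "card (set ss) \<le> p" using card_length[of ss] len_ss by simp
  ultimately show False using p by linarith
qed

lemma cat_prefs_imp_park_all:
  assumes m: "m \<ge> 1" and N: "N = m * (n - 1) + 1" and c: "c \<in> cat_prefs m N"
  shows "\<exists>ss. park_all (cat_edges m n) {} c ss"
proof -
  have len: "length c = N" using c by (simp add: cat_prefs_def)
  have "\<exists>ss. park_all (cat_edges m n) {} (take p c) ss" if "p \<le> N" for p
    using that
  proof (induction p)
    case 0
    show ?case by (auto intro: park_all.Nil)
  next
    case (Suc p)
    then obtain ss where ss: "park_all (cat_edges m n) {} (take p c) ss" by auto
    then obtain s where s: "parks_at (cat_edges m n) (set ss) (c ! p) s"
      using cat_prefs_next_car_parks[OF m N c _ ss] Suc.prems by auto
    have "park_all (cat_edges m n) {} (take p c @ [c ! p]) (ss @ [s])"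
      using ss s Suc.prems len by (auto simp: park_all_iff nth_append less_Suc_eq)
    then show ?case
      using Suc.prems len by (auto simp: take_Suc_conv_app_nth)
  qed
  from this[of N] len show ?thesis by simp
qed

lemma PK_cat_eq_cat_prefs:
  assumes m: "m \<ge> 1"
  shows "PK_cat m n = cat_prefs m (m * (n - 1) + 1)"
proof (intro set_eqI iffI)
  fix c assume "c \<in> PK_cat m n"
  then show "c \<in> cat_prefs m (m * (n - 1) + 1)"
    using park_all_imp_cat_prefs[OF m refl] by (auto simp: PK_cat_def cat_vertices_def backbone_def)
next
  fix c assume c: "c \<in> cat_prefs m (m * (n - 1) + 1)"
  then have "set c \<subseteq> {1..m * (n - 1) + 1}"
    by (fastforce simp: cat_prefs_def in_set_conv_nth)
  with c cat_prefs_imp_park_all[OF m refl c]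
  show "c \<in> PK_cat m n"
    by (auto simp: PK_cat_def cat_vertices_def backbone_def cat_prefs_def)
qed

text \<open>
  A lucky car at \<open>v = m j + 1\<close> finds \<open>v\<close> free, so \<open>v\<close> was a barrier for all cars before it, and they fit into
  the \<open>m j\<close> smaller labels; by the bound on the preferences there are at least \<open>m j\<close> of them.  Conversely, if
  the car at position \<open>p\<close> prefers \<open>p + 1\<close>, then no car from there on can take one of the places up to \<open>p\<close>,
  so exactly these are occupied when it arrives.
\<close>

lemma luck_cat_eq:
  assumes m: "m \<ge> 1" and n: "n \<ge> 1" and N: "N = m * (n - 1) + 1" and c: "c \<in> cat_prefs m N"
  shows "luck_cat m n c = card {i. i < N \<and> m dvd i \<and> c ! i = i + 1}"
proof -
  obtain ss where park: "park_all (cat_edges m n) {} c ss"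
    using cat_prefs_imp_park_all[OF m N c] by blast
  have len: "length c = N" and sorted: "sorted c"
    and bounds: "\<And>i. i < N \<Longrightarrow> 1 \<le> c ! i \<and> c ! i \<le> i + 1"
    using c by (auto simp: cat_prefs_def)
  have set_c: "set c \<subseteq> {1..N}"
    using bounds len by (fastforce simp: in_set_conv_nth)
  note P = park_all_cat[OF m N len set_c park]
  have places: "parking_places (cat_edges m n) c = ss"
    unfolding parking_places_def
    using park park_all_unique[OF single_valued_cat_edges] by blast
  have "c ! p \<in> backbone m ` {1..n} \<and> ss ! p = c ! p \<longleftrightarrow> m dvd p \<and> c ! p = p + 1" if p: "p < N" for p
  proof
    assume "c ! p \<in> backbone m ` {1..n} \<and> ss ! p = c ! p"
    then obtain j where j: "c ! p = m * j + 1" and ss_p: "ss ! p = m * j + 1"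
      by (auto simp: backbone_def)
    let ?K = "m * j + 1"
    have K_free: "?K \<notin> set (take p ss)"
      using parks_at_not_occupied[OF P(4)[OF p]] ss_p by simp
    have before: "ss ! i \<in> {1..m * j}" if i: "i < p" for i
    proof -
      have "i < N" using i p by simp
      have "c ! i \<le> ?K" using sorted_nth_mono[OF sorted, of i p] i p len j by simp
      moreover have "set (take i ss) \<subseteq> set (take p ss)" using i by (intro set_take_subset_set_take) simp
      then have "?K \<notin> set (take i ss)" using K_free by blast
      ultimately have "ss ! i \<le> ?K"
        using parks_at_le_free_backbone[OF m P(4)[OF \<open>i < N\<close>]] by blast
      moreover have "ss ! i \<noteq> ?K"
        using K_free i p P(1) by (metis in_set_conv_nth length_take min.absorb2 nat_less_le nth_take)
      moreover have "1 \<le> ss ! i" using P(1,3) \<open>i < N\<close> by (metis atLeastAtMost_iff nth_mem)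
      ultimately show ?thesis by simp
    qed
    have "inj_on ((!) ss) {..<p}"
      using P(1,2) p by (intro inj_on_nth) auto
    then have "card {..<p} \<le> card {1..m * j}"
      using before by (intro card_inj_on_le) auto
    then have "p = m * j" using bounds[OF p] j by simp
    with j show "m dvd p \<and> c ! p = p + 1" by simp
  next
    assume *: "m dvd p \<and> c ! p = p + 1"
    then obtain j where j: "p = m * j" by auto
    with p N have "m * j \<le> m * (n - 1)" by linarith
    with m have "j \<le> n - 1" by (simp add: Suc_le_eq)
    then have prefers_backbone: "c ! p \<in> backbone m ` {1..n}"
      using * j n by (intro image_eqI[of _ _ "j + 1"]) (auto simp: backbone_def)
    have "{i. i < N \<and> c ! i \<le> p} \<subseteq> {..<p}"
    proof
      fix i assume i: "i \<in> {i. i < N \<and> c ! i \<le> p}"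
      show "i \<in> {..<p}"
      proof (rule ccontr)
        assume "i \<notin> {..<p}"
        with i sorted len have "c ! p \<le> c ! i" by (auto intro: sorted_nth_mono)
        with * i show False by simp
      qed
    qed
    then have "{1..p} \<subseteq> (!) ss ` {..<p}"
      using small_places_from_small_preferences[OF m N len set_c park, of p] p by force
    then have "(!) ss ` {..<p} = {1..p}"
      using card_image_le[of "{..<p}" "(!) ss"] by (intro card_seteq[symmetric]) auto
    moreover have "set (take p ss) = (!) ss ` {..<p}"
      using p P(1) by (simp add: nth_image lessThan_atLeast0)
    ultimately have "c ! p \<notin> set (take p ss)" using * by simp
    then have "ss ! p = c ! p" using parks_at_preferred_free P(4)[OF p] by metis
    with prefers_backbone show "c ! p \<in> backbone m ` {1..n} \<and> ss ! p = c ! p" by simp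
  qed
  then show ?thesis
    unfolding luck_cat_def places len by (intro arg_cong[of _ _ card]) auto
qed

section \<open>Suffixes of caterpillar parking distributions\<close>

text \<open>
  The possible preferences of the remaining cars after \<open>i\<close> cars with preferences up to \<open>k\<close>, if
  label \<open>k\<close> has already received its mandatory car but may receive more.  The excess is \<open>i - k\<close>.
\<close>

definition cat_suffixes :: "nat \<Rightarrow> nat \<Rightarrow> nat \<Rightarrow> nat \<Rightarrow> nat list set" where
  "cat_suffixes m N i k = {c. length c + i = N \<and> sorted c \<and> (\<forall>x\<in>set c. k \<le> x) \<and>
     (\<forall>j<length c. c ! j \<le> i + j + 1) \<and>
     (\<forall>l\<in>{k<..N}. \<not> m dvd l - 1 \<longrightarrow> l \<in> set c)}"

text \<open>
  The statistics mark only the cars at the labels \<open>1, \<dots>, m\<close>.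
\<close>

definition label_var :: "nat \<Rightarrow> (nat \<Rightarrow> 'a::comm_ring_1) \<Rightarrow> nat \<Rightarrow> 'a" where
  "label_var m q l = (if l \<le> m then q l else 1)"

definition cat_weight :: "nat \<Rightarrow> (nat \<Rightarrow> 'a::comm_ring_1) \<Rightarrow> nat \<Rightarrow> nat list \<Rightarrow> 'a" where
  "cat_weight m q i c = (\<Prod>j<length c.
     (if m dvd i + j \<and> c ! j = i + j + 1 then q 0 else 1) * label_var m q (c ! j))"

lemma cat_weight_Nil: "cat_weight m q i [] = 1"
  by (simp add: cat_weight_def)

lemma cat_weight_Cons:
  "cat_weight m q i (x # c) =
     (if m dvd i \<and> x = i + 1 then q 0 else 1) * label_var m q x * cat_weight m q (Suc i) c"
  by (simp add: cat_weight_def prod.lessThan_Suc_shift del: prod.lessThan_Suc)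

lemma finite_cat_suffixes: "finite (cat_suffixes m N i k)"
proof (rule finite_subset)
  show "cat_suffixes m N i k \<subseteq> {c. set c \<subseteq> {..N} \<and> length c = N - i}"
    by (fastforce simp: cat_suffixes_def in_set_conv_nth)
  show "finite {c. set c \<subseteq> {..N} \<and> length c = N - i}"
    by (rule finite_lists_length_eq) simp
qed

lemma cat_suffixes_too_many: "i > N \<Longrightarrow> cat_suffixes m N i k = {}"
  by (auto simp: cat_suffixes_def)

lemma cat_suffixes_final: "cat_suffixes m N N N = {[]}"
  by (auto simp: cat_suffixes_def)

lemma Cons_same_mem_cat_suffixes:
  "k # c \<in> cat_suffixes m N i k \<longleftrightarrow> k \<le> i + 1 \<and> c \<in> cat_suffixes m N (Suc i) k"
  by (auto simp: cat_suffixes_def All_less_Suc2)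

lemma Ball_greaterThanAtMost_Suc:
  "k < N \<Longrightarrow> (\<forall>l\<in>{k<..N}. P l) \<longleftrightarrow> P (Suc k) \<and> (\<forall>l\<in>{Suc k<..N}. P l)"
  by (metis Suc_lessD Suc_lessI Suc_leI greaterThanAtMost_iff lessI)

lemma Cons_next_mem_cat_suffixes:
  "Suc k # c \<in> cat_suffixes m N i k \<longleftrightarrow> k \<le> i \<and> c \<in> cat_suffixes m N (Suc i) (Suc k)"
proof (cases "k \<le> i \<and> length c + Suc i = N")
  case True
  then have "k < N" by simp
  have "(\<forall>l\<in>{Suc k<..N}. \<not> m dvd l - 1 \<longrightarrow> l \<in> set (Suc k # c)) \<longleftrightarrow>
      (\<forall>l\<in>{Suc k<..N}. \<not> m dvd l - 1 \<longrightarrow> l \<in> set c)"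
    by (intro ball_cong) auto
  with True show ?thesis
    unfolding cat_suffixes_def mem_Collect_eq Ball_greaterThanAtMost_Suc[OF \<open>k < N\<close>]
    by (auto simp: All_less_Suc2 Suc_le_eq less_imp_le)
qed (auto simp: cat_suffixes_def)

text \<open>
  Either the next car prefers \<open>k\<close>, or label \<open>k\<close> is finished.  In the latter case a leaf \<open>k + 1\<close> needs a car;
  a backbone vertex \<open>k + 1\<close> (that is, \<open>m\<close> divides \<open>k\<close>) needs one only if there is no excess.
\<close>

lemma cat_suffixes_split:
  assumes "k < N" "k \<le> i"
  shows "cat_suffixes m N i k = (#) k ` cat_suffixes m N (Suc i) k \<union>
    (if m dvd k \<and> k < i then cat_suffixes m N i (Suc k)
     else (#) (Suc k) ` cat_suffixes m N (Suc i) (Suc k))" (is "?L = ?A \<union> ?B")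
proof (intro set_eqI iffI)
  fix p assume p: "p \<in> ?L"
  show "p \<in> ?A \<union> ?B"
  proof (cases p)
    case Nil
    with p assms show ?thesis
      by (auto simp: cat_suffixes_def Ball_greaterThanAtMost_Suc)
  next
    case (Cons x c)
    show ?thesis
    proof (cases "x = k")
      case True
      with p Cons show ?thesis by (simp add: Cons_same_mem_cat_suffixes)
    next
      case False
      with p Cons have x: "k < x" by (auto simp: cat_suffixes_def)
      show ?thesis
      proof (cases "m dvd k \<and> k < i")
        case True
        from p Cons x have "p \<in> cat_suffixes m N i (Suc k)"
          by (fastforce simp: cat_suffixes_def)
        with True show ?thesis by simp
      next
        case False
        have "x \<le> Suc k"
        proof (cases "m dvd k")
          case True
          with False p Cons assms show ?thesis by (auto simp: cat_suffixes_def)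
        next
          case False
          with p Cons assms have "Suc k \<in> set (x # c)" by (simp add: cat_suffixes_def)
          with p Cons show ?thesis by (auto simp: cat_suffixes_def)
        qed
        with x have "x = Suc k" by simp
        with p Cons False show ?thesis by (auto simp: Cons_next_mem_cat_suffixes)
      qed
    qed
  qed
next
  fix p assume "p \<in> ?A \<union> ?B"
  then consider "p \<in> ?A" | "m dvd k" "p \<in> cat_suffixes m N i (Suc k)"
    | "p \<in> (#) (Suc k) ` cat_suffixes m N (Suc i) (Suc k)"
    by (auto split: if_splits)
  then show "p \<in> ?L"
  proof cases
    case 2
    then show ?thesis
      using assms by (auto simp: cat_suffixes_def Ball_greaterThanAtMost_Suc Suc_le_eq less_imp_le)
  qed (use assms in \<open>auto simp: Cons_same_mem_cat_suffixes Cons_next_mem_cat_suffixes\<close>)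
qed

definition cat_sum :: "nat \<Rightarrow> (nat \<Rightarrow> 'a::comm_ring_1) \<Rightarrow> nat \<Rightarrow> nat \<Rightarrow> nat \<Rightarrow> 'a" where
  "cat_sum m q N i k = (\<Sum>c\<in>cat_suffixes m N i k. cat_weight m q i c)"

lemma sum_Cons_image:
  "(\<Sum>c\<in>(#) x ` cat_suffixes m N (Suc i) k. cat_weight m q i c) =
     (if m dvd i \<and> x = i + 1 then q 0 else 1) * label_var m q x * cat_sum m q N (Suc i) k"
  by (simp add: sum.reindex cat_weight_Cons cat_sum_def sum_distrib_left)

lemma cat_sum_rec:
  assumes "k < N" "k \<le> i"
  shows "cat_sum m q N i k = label_var m q k * cat_sum m q N (Suc i) k +
    (if m dvd k
     then if k < i then cat_sum m q N i (Suc k)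
          else q 0 * label_var m q (Suc k) * cat_sum m q N (Suc i) (Suc k)
     else label_var m q (Suc k) * cat_sum m q N (Suc i) (Suc k))"
proof -
  let ?A = "(#) k ` cat_suffixes m N (Suc i) k"
  let ?B = "if m dvd k \<and> k < i then cat_suffixes m N i (Suc k)
     else (#) (Suc k) ` cat_suffixes m N (Suc i) (Suc k)"
  have "k # c \<notin> cat_suffixes m N i (Suc k)" for c
    by (simp add: cat_suffixes_def)
  then have disjoint: "?A \<inter> ?B = {}"
    by (cases "m dvd k \<and> k < i") auto
  have "cat_sum m q N i k = (\<Sum>c\<in>?A \<union> ?B. cat_weight m q i c)"
    unfolding cat_sum_def by (intro sum.cong cat_suffixes_split[OF assms] refl)
  also have "\<dots> = (\<Sum>c\<in>?A. cat_weight m q i c) + (\<Sum>c\<in>?B. cat_weight m q i c)"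
    by (intro sum.union_disjoint disjoint) (simp_all add: finite_cat_suffixes)
  also have "(\<Sum>c\<in>?A. cat_weight m q i c) = label_var m q k * cat_sum m q N (Suc i) k"
    using assms by (simp add: sum_Cons_image)
  also have "(\<Sum>c\<in>?B. cat_weight m q i c) =
    (if m dvd k
     then if k < i then cat_sum m q N i (Suc k)
          else q 0 * label_var m q (Suc k) * cat_sum m q N (Suc i) (Suc k)
     else label_var m q (Suc k) * cat_sum m q N (Suc i) (Suc k))"
  proof (cases "m dvd k \<and> k < i")
    case True
    then show ?thesis by (simp add: cat_sum_def)
  next
    case False
    with assms have "m dvd i \<and> Suc k = i + 1 \<longleftrightarrow> m dvd k" by auto
    with False show ?thesis by (simp only: sum_Cons_image if_False) simp
  qed
  finally show ?thesis .
qed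

section \<open>Generating functions of the suffix sums\<close>

text \<open>
  The series \<open>T = x C\<^sup>m\<close> for lowering the excess by one.
\<close>

abbreviation descent :: "nat \<Rightarrow> 'a::comm_ring_1 fps" where
  "descent m \<equiv> fps_X * fuss_catalan m ^ m"

text \<open>
  The blocks are \<open>1, \<dots>, m\<close>, then \<open>m + 1, \<dots>, 2 m\<close>, and so on: a backbone vertex with the leaves up to the next
  backbone vertex.
\<close>

definition block_end :: "nat \<Rightarrow> nat \<Rightarrow> nat" where
  "block_end m k = m * ((k - 1) div m + 1)"

text \<open>
  The series for the continuations from excess \<open>h\<close> after label \<open>k\<close> is finished: the remaining labels of its
  block contribute their mandatory and extra cars, and \<open>T\<^sup>h B\<^sub>m(x;q\<^sub>0)\<close> accounts for the later blocks.
  The exponent of \<open>x\<close> is the number of backbone vertices after \<open>k\<close>.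
\<close>

definition leave_fps :: "nat \<Rightarrow> (nat \<Rightarrow> 'a::comm_ring_1) \<Rightarrow> nat \<Rightarrow> nat \<Rightarrow> 'a fps" where
  "leave_fps m q h k = descent m ^ h * B_fps m (q 0) *
     (\<Prod>l\<in>{k<..block_end m k}. fps_const (label_var m q l) * B_fps m (label_var m q l))"

text \<open>
  The same as long as label \<open>k\<close> may still receive extra cars, to which the last factor is due.
\<close>

definition stay_fps :: "nat \<Rightarrow> (nat \<Rightarrow> 'a::comm_ring_1) \<Rightarrow> nat \<Rightarrow> nat \<Rightarrow> 'a fps" where
  "stay_fps m q h k = leave_fps m q h k * B_fps m (label_var m q k)"

text \<open>
  The equation \<open>B = 1 + t T B\<close> separates the case of no further car at \<open>k\<close> from that of one more.
\<close>

lemma stay_fps_rec: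
  "stay_fps m q h k =
     fps_const (label_var m q k) * stay_fps m q (Suc h) k + leave_fps m q h k"
proof -
  have "leave_fps m q h k * B_fps m (label_var m q k) =
      leave_fps m q h k * (1 + fps_const (label_var m q k) * descent m * B_fps m (label_var m q k))"
    by (subst B_fps_eq) (rule refl)
  also have "\<dots> = fps_const (label_var m q k) *
      (descent m * leave_fps m q h k * B_fps m (label_var m q k)) + leave_fps m q h k"
    by (simp only: distrib_left mult_1_left mult_1_right mult_ac add_ac)
  also have "descent m * leave_fps m q h k = leave_fps m q (Suc h) k"
    by (simp only: leave_fps_def power_Suc mult_ac)
  finally show ?thesis
    by (simp only: stay_fps_def)
qed

lemma div_eq_pred_div:
  fixes k m :: nat
  assumes "k \<ge> 1"
  shows "k div m = (if m dvd k then Suc ((k - 1) div m) else (k - 1) div m)"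
  using assms by (cases k) (auto simp: div_Suc dvd_eq_mod_eq_0)

lemma block_end_dvd: "m dvd k \<Longrightarrow> k \<ge> 1 \<Longrightarrow> block_end m k = k"
  using div_eq_pred_div[of k m] dvd_mult_div_cancel[of m k] by (simp add: block_end_def)

lemma block_end_Suc:
  assumes "k \<ge> 1"
  shows "block_end m (Suc k) = (if m dvd k then k + m else block_end m k)"
  using assms div_eq_pred_div[of k m] dvd_mult_div_cancel[of m k]
  by (auto simp: block_end_def)

lemma block_end_ge: "m \<ge> 1 \<Longrightarrow> k \<ge> 1 \<Longrightarrow> k \<le> block_end m k"
  using dividend_less_times_div[of m "k - 1"] by (simp add: block_end_def)

lemma leave_fps_leaf:
  assumes "m \<ge> 1" "k \<ge> 1" "\<not> m dvd k"
  shows "leave_fps m q h k = fps_const (label_var m q (Suc k)) * stay_fps m q h (Suc k)"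
proof -
  have "block_end m (Suc k) = block_end m k"
    using block_end_Suc[OF assms(2)] assms(3) by simp
  moreover have "Suc k \<le> block_end m (Suc k)"
    using assms by (intro block_end_ge) auto
  ultimately have "{k<..block_end m k} = insert (Suc k) {Suc k<..block_end m (Suc k)}"
    by auto
  then show ?thesis
    by (simp add: leave_fps_def stay_fps_def mult_ac)
qed

lemma stay_fps_after_first_block:
  assumes "k > m"
  shows "stay_fps m q h k =
    descent m ^ h * B_fps m (q 0) * fuss_catalan m ^ Suc (block_end m k - k)"
  using assms by (simp add: stay_fps_def leave_fps_def label_var_def B_fps_1 mult_ac)

text \<open>
  Passing to a backbone vertex gives a factor \<open>x\<close>.  With positive excess this uses up one unit; with excess zero,
  the equation \<open>B = 1 + q\<^sub>0 T B\<close> provides the lucky car with its \<open>q\<^sub>0\<close>, and the summand 1 stands for the end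
  of the backbone.
\<close>

lemma leave_fps_backbone:
  assumes "k \<ge> 1" "m dvd k"
  shows "leave_fps m q (Suc h) k = fps_X * stay_fps m q h (Suc k)"
    and "leave_fps m q 0 k = 1 + fps_const (q 0) * (fps_X * stay_fps m q 0 (Suc k))"
proof -
  have le: "1 \<le> m" "m \<le> k" using assms by (auto intro: dvd_imp_le simp: Suc_le_eq dvd_pos_nat)
  have leave: "leave_fps m q h k = descent m ^ h * B_fps m (q 0)" for h
    using assms by (simp add: leave_fps_def block_end_dvd)
  have "Suc (block_end m (Suc k) - Suc k) = m"
    using assms le by (auto simp: block_end_Suc)
  then have stay: "stay_fps m q h (Suc k) = descent m ^ h * B_fps m (q 0) * fuss_catalan m ^ m" for h
    using stay_fps_after_first_block[of m "Suc k" q h] assms le by simp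
  show "leave_fps m q (Suc h) k = fps_X * stay_fps m q h (Suc k)"
    unfolding leave stay by (simp only: power_Suc mult_ac)
  show "leave_fps m q 0 k = 1 + fps_const (q 0) * (fps_X * stay_fps m q 0 (Suc k))"
  proof -
    have "leave_fps m q 0 k = B_fps m (q 0)"
      by (simp add: leave)
    also have "\<dots> = 1 + fps_const (q 0) * (descent m * B_fps m (q 0))"
      unfolding mult.assoc[symmetric] by (rule B_fps_eq[unfolded mult.assoc[symmetric]])
    also have "descent m * B_fps m (q 0) = fps_X * stay_fps m q 0 (Suc k)"
      unfolding stay by (simp only: power_0 mult_1_left mult_ac)
    finally show ?thesis .
  qed
qed

text \<open>
  An excess cannot be undone with fewer backbone vertices than its size.
\<close>

lemma stay_fps_nth_eq_0: "d < h \<Longrightarrow> stay_fps m q h k $ d = 0"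
  by (simp add: stay_fps_def leave_fps_def power_mult_distrib mult.assoc fps_X_power_mult_nth)

lemma fuss_catalan_nth_0: "fuss_catalan m $ 0 = 1"
  by (simp add: B_fps_nth_0 flip: B_fps_1)

text \<open>
  Both sides satisfy the same recursion.  It ends at the last label, and at states with more than \<open>N\<close>
  cars, where there are no suffixes.  The assumption on \<open>n\<close> puts the root, which has no leaves after it in
  its block, outside the first block, so the series there does not contain variables for missing labels.
\<close>

lemma cat_sum_eq_stay_fps:
  assumes m: "m \<ge> 1" and n: "n \<ge> 2" and N: "N = m * (n - 1) + 1"
    and "1 \<le> k" "k \<le> i" "k \<le> N"
  shows "cat_sum m q N i k = stay_fps m q (i - k) k $ (n - 1 - (k - 1) div m)"
  using assms(4-)
proof (induction "(N - k) + (N + 1 - i)" arbitrary: i k rule: less_induct)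
  case less
  note IH = less.hyps
  show ?case
  proof (cases "k = N")
    case True
    have *: "(N - 1) div m = n - 1" using N m by simp
    have "N > m" using N n m by (cases "n - 1") auto
    show ?thesis
    proof (cases "i = N")
      case True
      with \<open>k = N\<close> \<open>N > m\<close> m show ?thesis unfolding \<open>k = N\<close> *
        by (simp add: cat_sum_def cat_suffixes_final cat_weight_Nil stay_fps_after_first_block
            B_fps_nth_0 fuss_catalan_nth_0 fps_power_zeroth_eq_one del: power_Suc)
    next
      case False
      with \<open>k = N\<close> less.prems have "i > N" by simp
      then show ?thesis unfolding \<open>k = N\<close> *
        by (simp add: cat_sum_def cat_suffixes_too_many stay_fps_nth_eq_0)
    qed
  next
    case False
    with less.prems have k: "k < N" by simp
    let ?d = "n - 1 - (k - 1) div m"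
    show ?thesis
    proof (cases "i > N")
      case True
      \<comment> \<open>There are more cars than labels, hence more excess than backbone vertices: of the \<open>N - k\<close>
        labels after \<open>k\<close>, exactly \<open>?d\<close> are on the backbone.\<close>
      have "?d \<le> N - k"
      proof -
        define b where "b = (k - 1) div m"
        have "k - 1 < (n - 1) * m" using k N less.prems by (simp add: mult.commute)
        then have "b < n - 1"
          using m by (simp add: b_def div_less_iff_less_mult)
        then obtain e where e: "n - 1 = b + Suc e"
          using less_imp_Suc_add by fastforce
        have "k - 1 < m * b + m"
          using dividend_less_times_div[of m "k - 1"] m by (simp add: b_def)
        then have "k \<le> m * b + m" by linarith
        moreover have "N = m * b + m + m * e + 1" by (simp only: N e) (simp add: algebra_simps)
        moreover have "e \<le> m * e" using m by simp
        moreover have "n - 1 - b = Suc e" using e by simp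
        ultimately show ?thesis unfolding b_def[symmetric] by linarith
      qed
      with True k have "?d < i - k" by linarith
      then show ?thesis using True
        by (simp add: cat_sum_def cat_suffixes_too_many stay_fps_nth_eq_0)
    next
      case False
      have stay: "cat_sum m q N (Suc i) k = stay_fps m q (Suc (i - k)) k $ ?d"
        using IH[of k "Suc i"] less.prems False by (simp add: Suc_diff_le)
      have leave: "(if m dvd k
         then if k < i then cat_sum m q N i (Suc k)
              else q 0 * label_var m q (Suc k) * cat_sum m q N (Suc i) (Suc k)
         else label_var m q (Suc k) * cat_sum m q N (Suc i) (Suc k)) = leave_fps m q (i - k) k $ ?d"
      proof (cases "m dvd k")
        case dvd: True
        have "k div m = Suc ((k - 1) div m)"
          using dvd less.prems div_eq_pred_div[of k m] by simp
        moreover have "k div m \<le> n - 1"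
          using k N m div_le_mono[of k "m * (n - 1)" m] by simp
        ultimately have d: "?d = Suc (n - 1 - k div m)" by linarith
        show ?thesis
        proof (cases "k < i")
          case True
          have "cat_sum m q N i (Suc k) = stay_fps m q (i - Suc k) (Suc k) $ (n - 1 - k div m)"
            using IH[of "Suc k" i] k True False by simp
          moreover have "i - k = Suc (i - Suc k)" using True by simp
          ultimately show ?thesis
            using dvd True less.prems m unfolding d by (simp add: leave_fps_backbone)
        next
          case False
          with less.prems have i: "i = k" by simp
          have "label_var m q (Suc k) = 1"
            using dvd_imp_le[OF dvd] less.prems by (simp add: label_var_def)
          moreover have "cat_sum m q N (Suc i) (Suc k) = stay_fps m q 0 (Suc k) $ (n - 1 - k div m)"
            using IH[of "Suc k" "Suc i"] k i by simp
          ultimately show ?thesis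
            using dvd less.prems m i unfolding d by (simp add: leave_fps_backbone)
        qed
      next
        case not_dvd: False
        have "k div m = (k - 1) div m"
          using not_dvd less.prems div_eq_pred_div[of k m] by simp
        then have "cat_sum m q N (Suc i) (Suc k) = stay_fps m q (i - k) (Suc k) $ ?d"
          using IH[of "Suc k" "Suc i"] k less.prems by simp
        with not_dvd less.prems m show ?thesis by (simp add: leave_fps_leaf)
      qed
      show ?thesis
        unfolding cat_sum_rec[OF k less.prems(2)] stay leave stay_fps_rec[of m q "i - k" k]
        by simp
    qed
  qed
qed

section \<open>The generating function of caterpillar parking distributions\<close>

lemma prod_label_var:
  assumes "\<forall>x\<in>set c. 1 \<le> x"
  shows "(\<Prod>j<length c. label_var m q (c ! j)) = (\<Prod>l=1..m. q l ^ count_list c l)"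
  using assms
proof (induction c)
  case (Cons x c)
  have "(\<Prod>l=1..m. q l ^ count_list (x # c) l) =
      (\<Prod>l=1..m. (if x = l then q l else 1) * q l ^ count_list c l)"
    by (intro prod.cong) auto
  also have "\<dots> = label_var m q x * (\<Prod>l=1..m. q l ^ count_list c l)"
    using Cons.prems by (simp add: prod.distrib prod.delta' label_var_def)
  finally show ?case
    using Cons by (simp add: prod.lessThan_Suc_shift del: prod.lessThan_Suc)
qed simp

lemma prod_cat_stat:
  assumes "m \<ge> 1" "n \<ge> 1" "c \<in> PK_cat m n"
  shows "(\<Prod>i=0..m. q i ^ cat_stat m n i c) = cat_weight m q 0 c"
proof -
  let ?N = "m * (n - 1) + 1"
  have c: "c \<in> cat_prefs m ?N"
    using assms by (simp add: PK_cat_eq_cat_prefs)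
  have len: "length c = ?N" using c by (simp add: cat_prefs_def)
  have "{0..m} = insert 0 {1..m}" by auto
  then have "(\<Prod>i=0..m. q i ^ cat_stat m n i c) =
      q 0 ^ luck_cat m n c * (\<Prod>l=1..m. q l ^ count_list c l)"
    by (simp add: cat_stat_def)
  also have "(\<Prod>l=1..m. q l ^ count_list c l) = (\<Prod>j<length c. label_var m q (c ! j))"
    using c by (intro prod_label_var[symmetric]) (auto simp: cat_prefs_def in_set_conv_nth)
  also have "q 0 ^ luck_cat m n c =
      (\<Prod>j<length c. if m dvd j \<and> c ! j = j + 1 then q 0 else 1)"
    unfolding luck_cat_eq[OF assms(1,2) refl c]
    by (simp add: prod.If_cases Int_def len del: prod.lessThan_Suc)
  finally show ?thesis
    by (simp add: cat_weight_def prod.distrib)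
qed

text \<open>
  The first car must prefer label 1, which thereby has its mandatory car.
\<close>

lemma cat_prefs_eq_Cons_image:
  assumes "N \<ge> 1"
  shows "cat_prefs m N = (#) 1 ` cat_suffixes m N 1 1"
proof -
  have leaves: "(\<forall>l. 1 \<le> l \<and> l \<le> N \<and> \<not> m dvd l - 1 \<longrightarrow> l \<in> set (1 # c)) \<longleftrightarrow>
      (\<forall>l\<in>{1<..N}. \<not> m dvd l - 1 \<longrightarrow> l \<in> set c)" (is "?all \<longleftrightarrow> ?rest") for c
  proof
    assume all: ?all
    show ?rest
    proof
      fix l assume "l \<in> {1<..N}"
      with all[rule_format, of l] show "\<not> m dvd l - 1 \<longrightarrow> l \<in> set c" by auto
    qed
  next
    assume rest: ?rest
    show ?all
    proof (intro allI impI)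
      fix l assume "1 \<le> l \<and> l \<le> N \<and> \<not> m dvd l - 1"
      with rest[rule_format, of l] show "l \<in> set (1 # c)" by (cases "l = 1") auto
    qed
  qed
  show ?thesis
  proof (intro set_eqI iffI)
    fix c assume c: "c \<in> cat_prefs m N"
    with assms obtain x c' where x: "c = x # c'" by (cases c) (auto simp: cat_prefs_def)
    with c assms have "x = 1" by (force simp: cat_prefs_def)
    have "c' \<in> cat_suffixes m N 1 1"
      using c unfolding x \<open>x = 1\<close> cat_prefs_def cat_suffixes_def mem_Collect_eq leaves
      by (auto simp: All_less_Suc2)
    with x \<open>x = 1\<close> show "c \<in> (#) 1 ` cat_suffixes m N 1 1" by simp
  next
    fix c assume "c \<in> (#) 1 ` cat_suffixes m N 1 1"
    then obtain c' where c: "c = 1 # c'" "c' \<in> cat_suffixes m N 1 1" by auto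
    then have N: "N = Suc (length c')" by (simp add: cat_suffixes_def)
    from c(2) show "c \<in> cat_prefs m N"
      unfolding c(1) cat_prefs_def cat_suffixes_def mem_Collect_eq leaves
      by (auto simp: N All_less_Suc2)
  qed
qed

text \<open>
  The first car is lucky, which gives \<open>q 0\<close>, and prefers label 1, which gives \<open>q 1\<close>.
\<close>

lemma sum_PK_cat:
  assumes "m \<ge> 1" "n \<ge> 1"
  shows "(\<Sum>c\<in>PK_cat m n. \<Prod>i=0..m. q i ^ cat_stat m n i c) =
    q 0 * q 1 * cat_sum m q (m * (n - 1) + 1) 1 1"
proof -
  have "(\<Sum>c\<in>PK_cat m n. \<Prod>i=0..m. q i ^ cat_stat m n i c) =
      (\<Sum>c\<in>(#) 1 ` cat_suffixes m (m * (n - 1) + 1) (Suc 0) 1. cat_weight m q 0 c)"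
    using assms by (intro sum.cong) (auto simp: prod_cat_stat PK_cat_eq_cat_prefs cat_prefs_eq_Cons_image)
  also have "\<dots> = q 0 * q 1 * cat_sum m q (m * (n - 1) + 1) 1 1"
    unfolding sum_Cons_image using assms by (simp add: label_var_def)
  finally show ?thesis .
qed

theorem corollary3:
  fixes m :: nat and q :: "nat \<Rightarrow> 'a::comm_ring_1"
  assumes "m \<ge> 1"
  shows "Abs_fps (\<lambda>n. if n = 0 then 1
             else \<Sum>c\<in>PK_cat m n. \<Prod>i=0..m. q i ^ cat_stat m n i c)
       = (1 + fps_X * (\<Prod>i=0..m. fps_const (q i) * B_fps m (q i)))
         - fps_X * fps_const ((\<Prod>i=0..m. q i) - q 0 * q 1)" (is "?L = ?R")
proof (rule fps_ext)
  fix n :: nat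
  let ?P = "\<Prod>i=0..m. fps_const (q i) * B_fps m (q i)"
  consider "n = 0" | "n = 1" | "n \<ge> 2" by linarith
  then show "?L $ n = ?R $ n"
  proof cases
    case 1
    then show ?thesis by simp
  next
    case 2
    \<comment> \<open>The product of series would give all variables, but there is only the root, whose car gives
      \<open>q 0 * q 1\<close>.\<close>
    have "(\<Prod>i\<in>A. fps_const (q i) * B_fps m (q i)) $ 0 = (\<Prod>i\<in>A. q i)" for A
      by (induction A rule: infinite_finite_induct) (simp_all add: B_fps_nth_0)
    moreover have "cat_sum m q 1 1 1 = 1"
      by (simp add: cat_sum_def cat_suffixes_final cat_weight_Nil del: One_nat_def)
    ultimately show ?thesis
      using 2 assms sum_PK_cat[of m n q] by simp
  next
    case 3
    have "?L $ n = q 0 * q 1 * cat_sum m q (m * (n - 1) + 1) 1 1"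
      using 3 assms sum_PK_cat[of m n q] by simp
    also have "cat_sum m q (m * (n - 1) + 1) 1 1 = stay_fps m q 0 1 $ (n - 1)"
      using cat_sum_eq_stay_fps[OF assms 3 refl, of 1 1 q] by simp
    also have "q 0 * q 1 * stay_fps m q 0 1 $ (n - 1) =
        (fps_const (q 0 * q 1) * stay_fps m q 0 1) $ (n - 1)"
      by simp
    also have "fps_const (q 0 * q 1) * stay_fps m q 0 1 = ?P"
    proof -
      have "{0..m} = insert 0 (insert 1 {1<..m})" using assms by auto
      then have "?P = (fps_const (q 0) * B_fps m (q 0)) * ((fps_const (q 1) * B_fps m (q 1)) *
          (\<Prod>i\<in>{1<..m}. fps_const (q i) * B_fps m (q i)))"
        by simp
      also have "(\<Prod>i\<in>{1<..m}. fps_const (q i) * B_fps m (q i)) =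
          (\<Prod>i\<in>{1<..block_end m 1}. fps_const (label_var m q i) * B_fps m (label_var m q i))"
        by (intro prod.cong) (auto simp: block_end_def label_var_def)
      finally show ?thesis
        using assms
        by (simp add: stay_fps_def leave_fps_def label_var_def mult_ac flip: fps_const_mult)
    qed
    also have "?P $ (n - 1) = ?R $ n"
      using 3 by (simp add: numeral_2_eq_2)
    finally show ?thesis .
  qed
qed

end
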